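(* For each even integer $p\ge 4$, there exists at least one sign-unbalanced nut graph $\Gamma=(G,\Sigma)$ whose underlying graph $G$ is the cocktail-party graph of order $2p$, $\mathrm{CP}(2p)\cong\overline{p\,K_2}$.
   Context: The cocktail-party graph $\mathrm{CP}(2p)$ is the complement of the disjoint union $pK_2$ of $p$ edges. A signed graph $\Gamma=(G,\Sigma)$ is a finite simple graph $G=(V,E)$ (the underlying graph) with a distinguished set $\Sigma\subseteq E$ of negative edges. Its adjacency matrix $A(\Gamma)$ is obtained from the $0$-$1$ adjacency matrix of $G$ by replacing $1$ by $-1$ at entries corresponding to negative edges. A vector indexed by $V$ is full if it has no zero entry. $\Gamma$ is a signed nut graph if $\dim\ker A(\Gamma)=1$ and $\ker A(\Gamma)$ contains a full vector. Switching $\Gamma$ at $U\subseteq V$ produces $\Gamma^U=(G,\Sigma\,\triangle\,\partial U)$, where $\triangle$ is symmetric difference and $\partial U=\{uv\in E: u\in U, v\notin U\}$; two signed graphs over the same $G$ are switching equivalent if one is obtained from the other by a switching. $\Gamma=(G,\Sigma)$ is sign-balanced if it is switching equivalent to $(G,\emptyset)$, and sign-unbalanced otherwise. A sign-unbalanced nut graph is a signed nut graph that is sign-unbalanced. *)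

theory Defs
  imports Complex_Main "HOL-Library.Function_Algebras"
begin

record 'a ugraph =
  verts :: "'a set"
  edges :: "'a set set"

definition finite_simple_graph :: "'a ugraph \<Rightarrow> bool" where
  "finite_simple_graph G \<longleftrightarrow>
     finite (verts G) \<and> (\<forall>e \<in> edges G. e \<subseteq> verts G \<and> card e = 2)"

definition graph_complement :: "'a ugraph \<Rightarrow> 'a ugraph" where
  "graph_complement G =
     \<lparr> verts = verts G, edges = {e. e \<subseteq> verts G \<and> card e = 2} - edges G \<rparr>"

definition disjoint_K2 :: "nat \<Rightarrow> (nat \<times> bool) ugraph" where
  "disjoint_K2 p =
     \<lparr> verts = {..<p} \<times> UNIV, edges = {{(i, False), (i, True)} | i. i < p} \<rparr>"

text \<open>The argument is the number \<open>p\<close> of removed edges, so the graph has order \<open>2 * p\<close>.\<close>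

definition cocktail_party :: "nat \<Rightarrow> (nat \<times> bool) ugraph" where
  "cocktail_party p = graph_complement (disjoint_K2 p)"

record 'a sgraph =
  underlying :: "'a ugraph"
  neg_edges :: "'a set set"

definition signed_graph :: "'a sgraph \<Rightarrow> bool" where
  "signed_graph \<Gamma> \<longleftrightarrow>
     finite_simple_graph (underlying \<Gamma>) \<and> neg_edges \<Gamma> \<subseteq> edges (underlying \<Gamma>)"

definition adjacency :: "'a sgraph \<Rightarrow> 'a \<Rightarrow> 'a \<Rightarrow> real" where
  "adjacency \<Gamma> u v =
     (if {u, v} \<in> edges (underlying \<Gamma>)
      then if {u, v} \<in> neg_edges \<Gamma> then - 1 else 1
      else 0)"

text \<open>
  Vectors indexed by the vertex set \<open>V\<close> are represented by functions that vanish outside \<open>V\<close>,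
  so that each vector has exactly one representative and dimensions are not affected by the
  values outside \<open>V\<close>.
\<close>

definition adjacency_kernel :: "'a sgraph \<Rightarrow> ('a \<Rightarrow> real) set" where
  "adjacency_kernel \<Gamma> =
     {x. (\<forall>v. v \<notin> verts (underlying \<Gamma>) \<longrightarrow> x v = 0) \<and>
         (\<forall>u \<in> verts (underlying \<Gamma>).
            (\<Sum>v \<in> verts (underlying \<Gamma>). adjacency \<Gamma> u v * x v) = 0)}"

interpretation fun_space: vector_space "\<lambda>(c :: real) (x :: 'a \<Rightarrow> real) v. c * x v"
  by unfold_locales (auto simp: fun_eq_iff algebra_simps)

definition full_vector :: "'a sgraph \<Rightarrow> ('a \<Rightarrow> real) \<Rightarrow> bool" where
  "full_vector \<Gamma> x \<longleftrightarrow> (\<forall>v \<in> verts (underlying \<Gamma>). x v \<noteq> 0)"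

definition signed_nut_graph :: "'a sgraph \<Rightarrow> bool" where
  "signed_nut_graph \<Gamma> \<longleftrightarrow>
     signed_graph \<Gamma> \<and>
     fun_space.dim (adjacency_kernel \<Gamma>) = 1 \<and>
     (\<exists>x \<in> adjacency_kernel \<Gamma>. full_vector \<Gamma> x)"

definition edge_boundary :: "'a ugraph \<Rightarrow> 'a set \<Rightarrow> 'a set set" where
  "edge_boundary G U = {{u, v} | u v. {u, v} \<in> edges G \<and> u \<in> U \<and> v \<notin> U}"

definition switching :: "'a sgraph \<Rightarrow> 'a set \<Rightarrow> 'a sgraph" where
  "switching \<Gamma> U =
     \<lparr> underlying = underlying \<Gamma>,
       neg_edges = sym_diff (neg_edges \<Gamma>) (edge_boundary (underlying \<Gamma>) U) \<rparr>"

definition switching_equivalent :: "'a sgraph \<Rightarrow> 'a sgraph \<Rightarrow> bool" where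
  "switching_equivalent \<Gamma> \<Gamma>' \<longleftrightarrow>
     (\<exists>U. U \<subseteq> verts (underlying \<Gamma>) \<and> \<Gamma>' = switching \<Gamma> U)"

definition sign_balanced :: "'a sgraph \<Rightarrow> bool" where
  "sign_balanced \<Gamma> \<longleftrightarrow>
     switching_equivalent \<Gamma> \<lparr> underlying = underlying \<Gamma>, neg_edges = {} \<rparr>"

definition sign_unbalanced_nut_graph :: "'a sgraph \<Rightarrow> bool" where
  "sign_unbalanced_nut_graph \<Gamma> \<longleftrightarrow> signed_nut_graph \<Gamma> \<and> \<not> sign_balanced \<Gamma>"

end

theory Submission
  imports Defs
begin

text \<open>
  Number the non-adjacent pairs of vertices \<open>0, \<dots>, p - 1\<close> and arrange them in a cycle. The
  adjacency matrix then consists of \<open>2 \<times> 2\<close> blocks, zero on the diagonal, and the signs are chosen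
  as follows: the block from a pair to its successor on the cycle is \<open>M = ((-1, 1), (-1, -1))\<close>, the
  block back is the transpose of \<open>M\<close>, and every other block \<open>(i, j)\<close> has all four entries equal to
  \<open>(-1)\<^sup>i\<^sup>+\<^sup>j\<close>. Because \<open>p\<close> is even, these alternating signs fit together around the cycle.

  For a vector \<open>x\<close>, let \<open>s\<^sub>i\<close> and \<open>d\<^sub>i\<close> be the sum and the difference of its two entries at pair
  \<open>i\<close>, and let \<open>T\<close> be the alternating sum of the \<open>s\<^sub>i\<close>. With indices taken around the cycle, the two
  kernel equations at pair \<open>i\<close> are
  \<open>(-1)\<^sup>i T - s\<^sub>i + s\<^sub>i\<^sub>+\<^sub>1 = d\<^sub>i\<^sub>+\<^sub>1\<close> and \<open>(-1)\<^sup>i T - s\<^sub>i + s\<^sub>i\<^sub>-\<^sub>1 + d\<^sub>i\<^sub>-\<^sub>1 = 0\<close>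
  (\<open>cyclic_cocktail_party_row\<close>). The second one at \<open>i + 1\<close> reads
  \<open>d\<^sub>i = (-1)\<^sup>i T + s\<^sub>i\<^sub>+\<^sub>1 - s\<^sub>i\<close>, and the first one says that \<open>d\<^sub>i\<^sub>+\<^sub>1\<close> has the same value. So \<open>d\<close> is
  constant, and adding up over the cycle gives \<open>d = 0\<close>. What is left,
  \<open>s\<^sub>i\<^sub>+\<^sub>1 = s\<^sub>i - (-1)\<^sup>i T\<close>, gives \<open>-T = T - p T\<close> when summed with alternating signs, whence
  \<open>T = 0\<close> and \<open>s\<close> is constant (\<open>cyclic_cocktail_party_kernel_solution\<close>). Therefore the kernel
  consists of the constant vectors.

  Balance would make the product of the signs around every closed walk positive
  (\<open>not_sign_balanced_if_negative_quadrangle\<close>), but the four entries of \<open>M\<close> are the signs of a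
  quadrangle on two consecutive pairs, and their product is \<open>-1\<close>.
\<close>

section \<open>Signed graphs with a one-dimensional kernel, and balance\<close>

lemma signed_nut_graph_if_kernel_is_line:
  assumes "signed_graph \<Gamma>" and "verts (underlying \<Gamma>) \<noteq> {}"
    and ker: "adjacency_kernel \<Gamma> = {\<lambda>v. c * y v | c. True}"
    and full: "full_vector \<Gamma> y"
  shows "signed_nut_graph \<Gamma>"
proof -
  have "y \<noteq> 0"
    using assms(2) full by (auto simp: full_vector_def)
  then have indep: "\<not> fun_space.dependent {y}"
    by simp
  have "adjacency_kernel \<Gamma> = fun_space.span {y}"
    unfolding ker fun_space.span_singleton by auto
  then have "fun_space.dim (adjacency_kernel \<Gamma>) = 1"
    using fun_space.dim_span_eq_card_independent[OF indep] by simp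
  moreover have "y \<in> adjacency_kernel \<Gamma>"
    unfolding ker by (auto intro: exI[of _ 1])
  ultimately show ?thesis
    using assms(1) full by (auto simp: signed_nut_graph_def)
qed

text \<open>
  If switching at \<open>U\<close> removes all negative edges, then the negative edges are those that cross the
  boundary of \<open>U\<close>, so \<open>\<theta>\<close> can be taken to be \<open>-1\<close> on \<open>U\<close> and \<open>1\<close> elsewhere.
\<close>

lemma sign_balanced_adjacency_factors:
  assumes "sign_balanced \<Gamma>"
  obtains \<theta> :: "'a \<Rightarrow> real"
  where "\<And>u v. {u, v} \<in> edges (underlying \<Gamma>) \<Longrightarrow> adjacency \<Gamma> u v = \<theta> u * \<theta> v"
proof -
  obtain U where "sym_diff (neg_edges \<Gamma>) (edge_boundary (underlying \<Gamma>) U) = {}"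
    using assms by (auto simp: sign_balanced_def switching_equivalent_def switching_def)
  then have neg: "neg_edges \<Gamma> = edge_boundary (underlying \<Gamma>) U"
    by blast
  have boundary: "{u, v} \<in> edge_boundary (underlying \<Gamma>) U \<longleftrightarrow> (u \<in> U) \<noteq> (v \<in> U)"
    if "{u, v} \<in> edges (underlying \<Gamma>)" for u v
  proof -
    have "{v, u} \<in> edges (underlying \<Gamma>)"
      using that by (simp add: insert_commute)
    with that show ?thesis
      unfolding edge_boundary_def mem_Collect_eq doubleton_eq_iff by blast
  qed
  show ?thesis
  proof (rule that[of "\<lambda>v. if v \<in> U then - 1 else 1"])
    fix u v assume "{u, v} \<in> edges (underlying \<Gamma>)"
    then show "adjacency \<Gamma> u v = (if u \<in> U then - 1 else 1) * (if v \<in> U then - 1 else 1)"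
      using boundary[of u v] by (auto simp: adjacency_def neg)
  qed
qed

text \<open>
  If the signs factor as \<open>\<theta> u * \<theta> v\<close>, each vertex of the quadrangle contributes its value of \<open>\<theta>\<close>
  twice, so the product of the four signs is a square.
\<close>

lemma not_sign_balanced_if_negative_quadrangle:
  assumes "{u, v} \<in> edges (underlying \<Gamma>)" "{v, w} \<in> edges (underlying \<Gamma>)"
    and "{w, z} \<in> edges (underlying \<Gamma>)" "{z, u} \<in> edges (underlying \<Gamma>)"
    and neg: "adjacency \<Gamma> u v * adjacency \<Gamma> v w * adjacency \<Gamma> w z * adjacency \<Gamma> z u < 0"
  shows "\<not> sign_balanced \<Gamma>"
proof
  assume "sign_balanced \<Gamma>"
  then obtain \<theta> where "\<And>u v. {u, v} \<in> edges (underlying \<Gamma>) \<Longrightarrow> adjacency \<Gamma> u v = \<theta> u * \<theta> v"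
    by (rule sign_balanced_adjacency_factors) blast
  then have "adjacency \<Gamma> u v * adjacency \<Gamma> v w * adjacency \<Gamma> w z * adjacency \<Gamma> z u
      = (\<theta> u * \<theta> v * \<theta> w * \<theta> z)\<^sup>2"
    using assms(1-4) by (simp add: power2_eq_square algebra_simps)
  then show False
    using neg by (simp add: not_less[symmetric])
qed

section \<open>Cyclic succession of the non-adjacent pairs\<close>

definition cyc_succ :: "nat \<Rightarrow> nat \<Rightarrow> nat" where
  "cyc_succ p i = (if Suc i = p then 0 else Suc i)"

lemma cyc_succ_less: "i < p \<Longrightarrow> cyc_succ p i < p"
  by (auto simp: cyc_succ_def)

lemma cyc_succ_eq_iff: "i < p \<Longrightarrow> j < p \<Longrightarrow> cyc_succ p i = cyc_succ p j \<longleftrightarrow> i = j"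
  by (auto simp: cyc_succ_def)

lemma cyc_pred_ex: "i < p \<Longrightarrow> \<exists>h<p. cyc_succ p h = i"
  by (cases i) (auto simp: cyc_succ_def intro: exI[of _ "p - 1"])

lemma cyc_succ_neq: "2 \<le> p \<Longrightarrow> cyc_succ p i \<noteq> i"
  by (auto simp: cyc_succ_def)

lemma cyc_succ_succ_neq: "3 \<le> p \<Longrightarrow> cyc_succ p (cyc_succ p i) \<noteq> i"
  by (auto simp: cyc_succ_def)

lemma sum_cyc_succ:
  fixes f :: "nat \<Rightarrow> real"
  shows "(\<Sum>i<p. f (cyc_succ p i)) = (\<Sum>i<p. f i)"
proof (rule sum.reindex_bij_betw, rule bij_betwI')
  show "\<exists>h\<in>{..<p}. i = cyc_succ p h" if "i \<in> {..<p}" for i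
    using cyc_pred_ex[of i p] that by blast
qed (simp_all add: cyc_succ_less cyc_succ_eq_iff)

lemma minus_one_power_cyc_succ:
  assumes "even p" "i < p"
  shows "(- 1 :: real) ^ cyc_succ p i = - ((- 1) ^ i)"
proof (cases "Suc i = p")
  case True
  then have "odd i" using assms(1) by auto
  with True show ?thesis by (simp add: cyc_succ_def)
qed (simp add: cyc_succ_def)

lemma sum_alternating_signs:
  assumes "even p"
  shows "(\<Sum>i<p. (- 1 :: real) ^ i) = 0"
proof -
  have "(\<Sum>i<2 * k. (- 1 :: real) ^ i) = 0" for k :: nat
    by (induction k) simp_all
  then show ?thesis
    using assms by (auto elim!: evenE)
qed

section \<open>The signed cocktail-party graph\<close>

text \<open>
  The vertex \<open>(i, a)\<close> belongs to pair \<open>i\<close>, and \<open>False\<close> indexes the first row and column of a block.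
  The first case is the block \<open>M\<close>, the second its transpose. They exclude each other, and the signs
  are symmetric, once the cycle has at least three pairs.
\<close>

fun cyclic_sign :: "nat \<Rightarrow> nat \<times> bool \<Rightarrow> nat \<times> bool \<Rightarrow> real" where
  "cyclic_sign p (i, a) (j, b) =
     (if j = cyc_succ p i then (if \<not> a \<and> b then 1 else - 1)
      else if i = cyc_succ p j then (if \<not> b \<and> a then 1 else - 1)
      else (- 1) ^ (i + j))"

definition cyclic_cocktail_party :: "nat \<Rightarrow> (nat \<times> bool) sgraph" where
  "cyclic_cocktail_party p =
     \<lparr> underlying = cocktail_party p,
       neg_edges = {{u, v} | u v. {u, v} \<in> edges (cocktail_party p) \<and> cyclic_sign p u v = - 1} \<rparr>"

lemma verts_cocktail_party [simp]: "verts (cocktail_party p) = {..<p} \<times> UNIV"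
  by (simp add: cocktail_party_def graph_complement_def disjoint_K2_def)

lemma edge_cocktail_party_iff:
  "{(i, a), (j, b)} \<in> edges (cocktail_party p) \<longleftrightarrow> i < p \<and> j < p \<and> i \<noteq> j"
proof -
  have size: "{(i, a), (j, b)} \<subseteq> {..<p} \<times> UNIV \<and> card {(i, a), (j, b)} = 2
      \<longleftrightarrow> i < p \<and> j < p \<and> (i, a) \<noteq> (j, b)"
    by (auto simp: card_insert_if)
  have "{(i, a), (j, b)} = {(k, False), (k, True)} \<longleftrightarrow> i = k \<and> j = k \<and> a \<noteq> b" for k
    by (cases a; cases b) (auto simp: doubleton_eq_iff)
  then have removed: "{(i, a), (j, b)} \<in> {{(k, False), (k, True)} | k. k < p}
      \<longleftrightarrow> i < p \<and> i = j \<and> a \<noteq> b"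
    by simp blast
  show ?thesis
    using size removed
    unfolding cocktail_party_def graph_complement_def disjoint_K2_def ugraph.simps Diff_iff mem_Collect_eq
    by blast
qed

lemma underlying_cyclic_cocktail_party [simp]:
  "underlying (cyclic_cocktail_party p) = cocktail_party p"
  by (simp add: cyclic_cocktail_party_def)

lemma signed_graph_cyclic_cocktail_party: "signed_graph (cyclic_cocktail_party p)"
proof -
  have "e \<subseteq> verts (cocktail_party p) \<and> card e = 2" if "e \<in> edges (cocktail_party p)" for e
    using that by (simp add: cocktail_party_def graph_complement_def)
  then show ?thesis
    unfolding signed_graph_def finite_simple_graph_def underlying_cyclic_cocktail_party
    by (simp add: cyclic_cocktail_party_def) blast
qed

lemma cyclic_sign_commute:
  assumes "3 \<le> p"
  shows "cyclic_sign p u v = cyclic_sign p v u"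
proof -
  obtain i a j b where uv: "u = (i, a)" "v = (j, b)"
    by (metis surj_pair)
  have "\<not> (j = cyc_succ p i \<and> i = cyc_succ p j)"
    using cyc_succ_succ_neq[OF assms, of i] by metis
  then show ?thesis
    unfolding uv cyclic_sign.simps add.commute[of j i] by argo
qed

lemma cyclic_sign_cases: "cyclic_sign p u v = 1 \<or> cyclic_sign p u v = - 1"
proof -
  obtain i a j b where uv: "u = (i, a)" "v = (j, b)"
    by (metis surj_pair)
  have "(- 1 :: real) ^ (i + j) = 1 \<or> (- 1 :: real) ^ (i + j) = - 1"
    by (simp add: minus_one_power_iff)
  then show ?thesis
    unfolding uv cyclic_sign.simps by argo
qed

lemma adjacency_cyclic_cocktail_party:
  assumes "3 \<le> p" "i < p" "j < p"
  shows "adjacency (cyclic_cocktail_party p) (i, a) (j, b) =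
     (if i = j then 0 else cyclic_sign p (i, a) (j, b))"
proof -
  have "{(i, a), (j, b)} \<in> neg_edges (cyclic_cocktail_party p) \<longleftrightarrow>
      {(i, a), (j, b)} \<in> edges (cocktail_party p) \<and> cyclic_sign p (i, a) (j, b) = - 1"
    unfolding cyclic_cocktail_party_def sgraph.simps mem_Collect_eq doubleton_eq_iff
    using cyclic_sign_commute[OF assms(1), of "(i, a)" "(j, b)"] insert_commute[of "(i, a)" "(j, b)" "{}"]
    by metis
  then show ?thesis
    using cyclic_sign_cases[of p "(i, a)" "(j, b)"] assms(2,3)
    by (cases "cyclic_sign p (i, a) (j, b) = - 1")
      (simp_all add: adjacency_def edge_cocktail_party_iff del: cyclic_sign.simps)
qed

text \<open>
  If pair \<open>i\<close> had the alternating block with every pair, its row would evaluate to \<open>(-1)\<^sup>i T\<close>. Only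
  the blocks of \<open>i\<close> itself and of its two neighbours \<open>h\<close> and \<open>k\<close> on the cycle deviate, and \<open>M\<close> and
  its transpose send the entries at a pair to its \<open>s\<close> and \<open>d\<close>, up to sign and order. The row index is given through its
  predecessor \<open>h\<close> since only the successor function is at hand.
\<close>

lemma cyclic_cocktail_party_row:
  fixes x :: "nat \<times> bool \<Rightarrow> real" and p h :: nat
  defines "s \<equiv> \<lambda>j. x (j, False) + x (j, True)" and "d \<equiv> \<lambda>j. x (j, False) - x (j, True)"
  defines "T \<equiv> \<Sum>j<p. (- 1) ^ j * s j"
  assumes "even p" "3 \<le> p" "h < p"
  defines "i \<equiv> cyc_succ p h"
  defines "k \<equiv> cyc_succ p i"
  shows "(\<Sum>v \<in> {..<p} \<times> UNIV. adjacency (cyclic_cocktail_party p) (i, a) v * x v) =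
     (- 1) ^ i * T - s i + (if a then s h + d h else s k - d k)"
proof -
  have lt: "i < p" "k < p"
    using assms by (auto simp: cyc_succ_less)
  have ne: "i \<noteq> h" "k \<noteq> i" "k \<noteq> h"
    using assms by (auto simp: cyc_succ_neq cyc_succ_succ_neq)
  have pred: "i = cyc_succ p j \<longleftrightarrow> j = h" if "j < p" for j
    using that assms(6) cyc_succ_eq_iff[of j p h] by (auto simp: i_def)
  have sgn: "(- 1 :: real) ^ k = - ((- 1) ^ i)" "(- 1 :: real) ^ h = - ((- 1) ^ i)"
    using minus_one_power_cyc_succ[OF \<open>even p\<close>] lt \<open>h < p\<close> by (auto simp: k_def i_def)
  have sq: "(- 1 :: real) ^ i * ((- 1) ^ i * r) = r" for r
    by (simp add: minus_one_power_iff)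
  define g where "g j = (\<Sum>b\<in>UNIV. adjacency (cyclic_cocktail_party p) (i, a) (j, b) * x (j, b))" for j
  have g: "g j = (if j = i then 0
      else if j = k then (if a then - s k else - d k)
      else if j = h then (if a then d h else - s h)
      else (- 1) ^ i * ((- 1) ^ j * s j))" if "j < p" for j
    using that pred[OF that] lt \<open>3 \<le> p\<close>
    by (auto simp: g_def UNIV_bool adjacency_cyclic_cocktail_party s_def d_def k_def[symmetric]
        power_add algebra_simps)
  \<comment> \<open>Compare the row with that of the all-alternating matrix; the deviation sits on three pairs.\<close>
  have "(\<Sum>v \<in> {..<p} \<times> UNIV. adjacency (cyclic_cocktail_party p) (i, a) v * x v) = (\<Sum>j<p. g j)"
    unfolding g_def by (subst sum.cartesian_product) (simp add: case_prod_unfold)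
  also have "\<dots> = (\<Sum>j<p. (- 1) ^ i * ((- 1) ^ j * s j))
      + (\<Sum>j<p. g j - (- 1) ^ i * ((- 1) ^ j * s j))"
    by (simp add: sum_subtractf)
  also have "(\<Sum>j<p. g j - (- 1) ^ i * ((- 1) ^ j * s j))
      = (\<Sum>j\<in>{h, i, k}. g j - (- 1) ^ i * ((- 1) ^ j * s j))"
    using lt \<open>h < p\<close> by (intro sum.mono_neutral_right) (auto simp: g)
  also have "\<dots> = - s i + (if a then s h + d h else s k - d k)"
    using lt \<open>h < p\<close> ne ne[symmetric] by (simp add: g sgn sq)
  finally show ?thesis
    by (simp add: T_def sum_distrib_left)
qed

text \<open>
  The second row is used one step further along the cycle than the first one: shifted in this way,
  the two equations involve the same difference \<open>s (cyc_succ p i) - s i\<close>, which ties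
  \<open>d (cyc_succ p i)\<close> to \<open>d i\<close>. Evenness of \<open>p\<close> makes the signs cancel around the cycle, and
  \<open>p \<noteq> 2\<close> is what forces \<open>T = 0\<close>.
\<close>

lemma cyclic_cocktail_party_kernel_solution:
  fixes s d :: "nat \<Rightarrow> real" and p :: nat
  defines "T \<equiv> \<Sum>j<p. (- 1) ^ j * s j"
  assumes "even p" "3 \<le> p"
    and row_False: "\<And>i. i < p \<Longrightarrow> (- 1) ^ i * T - s i + (s (cyc_succ p i) - d (cyc_succ p i)) = 0"
    and row_True: "\<And>i. i < p \<Longrightarrow>
      (- 1) ^ cyc_succ p i * T - s (cyc_succ p i) + (s i + d i) = 0"
    and "i < p"
  shows "d i = 0" and "s i = s 0"
proof -
  have step: "d j = (- 1) ^ j * T + s (cyc_succ p j) - s j" "d (cyc_succ p j) = d j" if "j < p" for j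
    using row_False[OF that] row_True[OF that] that
    by (simp_all add: minus_one_power_cyc_succ[OF \<open>even p\<close>])
  have const: "f j = f 0" if "j < p" and "\<And>j. j < p \<Longrightarrow> f (cyc_succ p j) = f j"
    for f :: "nat \<Rightarrow> real" and j
    using that(1)
  proof (induction j)
    case (Suc j)
    then show ?case using that(2)[of j] by (simp add: cyc_succ_def)
  qed simp
  have d_const: "d j = d 0" if "j < p" for j
    using const[of j d] that step(2) by blast
  have "(\<Sum>j<p. d j) = (\<Sum>j<p. d 0)"
    by (rule sum.cong) (auto intro: d_const)
  then have "real p * d 0 = (\<Sum>j<p. d j)"
    by simp
  also have "\<dots> = (\<Sum>j<p. (- 1) ^ j) * T + (\<Sum>j<p. s (cyc_succ p j)) - (\<Sum>j<p. s j)"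
    using step(1) by (simp add: sum.distrib sum_subtractf sum_distrib_right)
  also have "\<dots> = 0"
    by (simp add: sum_cyc_succ sum_alternating_signs[OF \<open>even p\<close>])
  finally have "d 0 = 0"
    using \<open>3 \<le> p\<close> by simp
  then have d0: "d j = 0" if "j < p" for j
    using d_const[OF that] by simp
  then show "d i = 0"
    using \<open>i < p\<close> .
  \<comment> \<open>The alternating sum of the shifted \<open>s\<close> is again \<open>T\<close>; this yields \<open>(p - 2) T = 0\<close>.\<close>
  have "(- 1) ^ cyc_succ p j * s (cyc_succ p j) = T - (- 1) ^ j * s j" if "j < p" for j
  proof -
    have "s (cyc_succ p j) = s j - (- 1) ^ j * T"
      using step(1)[OF that] d0[OF that] by simp
    then show ?thesis
      using that
      by (cases "even j") (simp_all add: minus_one_power_cyc_succ[OF \<open>even p\<close>])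
  qed
  then have "(\<Sum>j<p. (- 1) ^ cyc_succ p j * s (cyc_succ p j)) = real p * T - T"
    by (simp add: sum_subtractf T_def)
  then have "T = real p * T - T"
    unfolding sum_cyc_succ[of "\<lambda>j. (- 1) ^ j * s j"] T_def .
  then have "(real p - 2) * T = 0"
    by (simp add: algebra_simps)
  then have "T = 0"
    using \<open>3 \<le> p\<close> by simp
  then have "s (cyc_succ p j) = s j" if "j < p" for j
    using step(1)[OF that] d0[OF that] by simp
  then show "s i = s 0"
    using const[of i s] \<open>i < p\<close> by blast
qed

lemma adjacency_kernel_cyclic_cocktail_party:
  assumes "even p" "3 \<le> p"
  shows "adjacency_kernel (cyclic_cocktail_party p) =
    {\<lambda>v. c * (if v \<in> {..<p} \<times> UNIV then 1 else 0) | c. True}"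
proof (intro equalityI subsetI)
  fix x assume "x \<in> adjacency_kernel (cyclic_cocktail_party p)"
  then have outside: "\<And>v. v \<notin> {..<p} \<times> UNIV \<Longrightarrow> x v = 0"
    and rows: "\<And>i a. i < p \<Longrightarrow>
      (\<Sum>v \<in> {..<p} \<times> UNIV. adjacency (cyclic_cocktail_party p) (i, a) v * x v) = 0"
    by (auto simp: adjacency_kernel_def)
  define s d where "s = (\<lambda>j. x (j, False) + x (j, True))" and "d = (\<lambda>j. x (j, False) - x (j, True))"
  define T where "T = (\<Sum>j<p. (- 1) ^ j * s j)"
  have row: "(- 1) ^ cyc_succ p h * T - s (cyc_succ p h) + (if a then s h + d h
      else s (cyc_succ p (cyc_succ p h)) - d (cyc_succ p (cyc_succ p h))) = 0" if "h < p" for h a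
    unfolding T_def s_def d_def
    by (rule trans[OF cyclic_cocktail_party_row[OF assms that, symmetric] rows[OF cyc_succ_less[OF that]]])
  have "(- 1) ^ i * T - s i + (s (cyc_succ p i) - d (cyc_succ p i)) = 0" if i: "i < p" for i
  proof -
    obtain h where "h < p" "cyc_succ p h = i"
      using cyc_pred_ex[OF i] by blast
    then show ?thesis
      using row[of h False] by simp
  qed
  moreover have "(- 1) ^ cyc_succ p i * T - s (cyc_succ p i) + (s i + d i) = 0" if "i < p" for i
    using row[OF that, of True] by simp
  ultimately have sol: "d i = 0" "s i = s 0" if "i < p" for i
    using cyclic_cocktail_party_kernel_solution[of p s d i] assms that by (auto simp: T_def)
  have "x (i, a) = s 0 / 2" if "i < p" for i a
    using sol[OF that] by (cases a) (auto simp: s_def d_def)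
  then have "x = (\<lambda>v. s 0 / 2 * (if v \<in> {..<p} \<times> UNIV then 1 else 0))"
    using outside by fastforce
  then show "x \<in> {\<lambda>v. c * (if v \<in> {..<p} \<times> UNIV then 1 else 0) | c. True}"
    by blast
next
  fix x :: "nat \<times> bool \<Rightarrow> real"
  assume "x \<in> {\<lambda>v. c * (if v \<in> {..<p} \<times> UNIV then 1 else 0) | c. True}"
  then obtain c where x: "x = (\<lambda>v. c * (if v \<in> {..<p} \<times> UNIV then 1 else 0))"
    by blast
  have "(\<Sum>v \<in> {..<p} \<times> UNIV. adjacency (cyclic_cocktail_party p) (i, a) v * x v) = 0"
    if i: "i < p" for i a
  proof -
    obtain h where h: "h < p" "cyc_succ p h = i"
      using cyc_pred_ex[OF i] by blast
    have "(\<Sum>j<p. (- 1) ^ j * (x (j, False) + x (j, True))) = (\<Sum>j<p. (- 1) ^ j) * (2 * c)"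
      by (simp add: x sum_distrib_right)
    also have "\<dots> = 0"
      by (simp add: sum_alternating_signs[OF assms(1)])
    finally show ?thesis
      using cyclic_cocktail_party_row[OF assms h(1), of a x] h that
      by (simp add: x cyc_succ_less)
  qed
  then show "x \<in> adjacency_kernel (cyclic_cocktail_party p)"
    by (auto simp: adjacency_kernel_def x)
qed

lemma not_sign_balanced_cyclic_cocktail_party:
  assumes "3 \<le> p"
  shows "\<not> sign_balanced (cyclic_cocktail_party p)"
proof (rule not_sign_balanced_if_negative_quadrangle)
  \<comment> \<open>The quadrangle alternates between the pairs 0 and 1, so its signs are the entries of \<open>M\<close>.\<close>
  show "adjacency (cyclic_cocktail_party p) (0, False) (1, False)
      * adjacency (cyclic_cocktail_party p) (1, False) (0, True)
      * adjacency (cyclic_cocktail_party p) (0, True) (1, True)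
      * adjacency (cyclic_cocktail_party p) (1, True) (0, False) < 0"
    using assms by (simp add: adjacency_cyclic_cocktail_party cyc_succ_def)
qed (use assms in \<open>auto simp: edge_cocktail_party_iff\<close>)

theorem theorem12:
  fixes p :: nat
  assumes "even p" and "p \<ge> 4"
  shows "\<exists>\<Gamma> :: (nat \<times> bool) sgraph.
           sign_unbalanced_nut_graph \<Gamma> \<and> underlying \<Gamma> = cocktail_party p"
proof (intro exI conjI)
  have "signed_nut_graph (cyclic_cocktail_party p)"
  proof (rule signed_nut_graph_if_kernel_is_line)
    show "adjacency_kernel (cyclic_cocktail_party p) =
        {\<lambda>v. c * (if v \<in> {..<p} \<times> UNIV then 1 else 0) | c. True}"
      using assms by (intro adjacency_kernel_cyclic_cocktail_party) auto
  qed (use assms in \<open>auto simp: signed_graph_cyclic_cocktail_party full_vector_def lessThan_empty_iff\<close>)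
  then show "sign_unbalanced_nut_graph (cyclic_cocktail_party p)"
    using assms by (simp add: sign_unbalanced_nut_graph_def not_sign_balanced_cyclic_cocktail_party)
qed simp

end
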